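(* Let $p\ge1$ be an integer and let $1\le\ell<d$ be integers. Let $\mathcal{F}_0=\{(V_j,v_j)\}_{j=1}^n$ be a family of linear subspaces $V_j\subset\mathbb{R}^\ell$ with positive weights $v_j$, and let $\mathcal{F}_1=\{(W_i,\omega_i)\}_{i=1}^m$ be a family of $\ell$-dimensional linear subspaces $W_i\subset\mathbb{R}^d$ with positive weights $\omega_i$. For each $i$, let $f_i:\mathbb{R}^\ell\to W_i$ be a linear isometry, and let $V_{i,j}:=f_i(V_j)\subset W_i$. If $\mathcal{F}_0$ is a tight $p$-fusion frame in $\mathbb{R}^\ell$ and $\mathcal{F}_1$ is a tight $p$-fusion frame in $\mathbb{R}^d$, then $$\mathcal{F}:=\{(V_{i,j},\omega_iv_j)\}_{1\le i\le m,\ 1\le j\le n}$$ is a tight $p$-fusion frame in $\mathbb{R}^d$.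
   Context: A finite family $\{(U_j,u_j)\}_{j}$ of linear subspaces $U_j$ of $\mathbb{R}^D$ with positive weights $u_j$ is a tight $p$-fusion frame in $\mathbb{R}^D$ if there is a constant $A>0$ such that $\sum_{j}u_j\|P_{U_j}(x)\|^{2p}=A\|x\|^{2p}$ for all $x\in\mathbb{R}^D$, where $P_U$ is the orthogonal projection onto $U$. *)

theory Defs
  imports "HOL-Analysis.Analysis"
begin

definition orth_proj :: "'a::euclidean_space set \<Rightarrow> 'a \<Rightarrow> 'a"
  where "orth_proj U x = (THE y. y \<in> U \<and> (\<forall>u\<in>U. orthogonal (x - y) u))"

lemma orth_proj_unique:
  assumes "subspace U" "y \<in> U" "\<forall>u\<in>U. orthogonal (x - y) u"
  shows "orth_proj U x = y"
  unfolding orth_proj_def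
proof (rule the_equality)
  show "y \<in> U \<and> (\<forall>u\<in>U. orthogonal (x - y) u)"
    using assms by simp
next
  fix z assume z: "z \<in> U \<and> (\<forall>u\<in>U. orthogonal (x - z) u)"
  have "y - z \<in> U"
    using assms(1,2) z by (simp add: subspace_diff)
  then have "(x - z) \<bullet> (y - z) = 0" "(x - y) \<bullet> (y - z) = 0"
    using z assms(3) by (auto simp: orthogonal_def)
  then have "(y - z) \<bullet> (y - z) = 0"
    by (simp add: inner_diff_left)
  then show "z = y" by simp
qed

lemma orth_proj:
  assumes "subspace U"
  shows "orth_proj U x \<in> U" and "\<And>u. u \<in> U \<Longrightarrow> orthogonal (x - orth_proj U x) u"
proof -
  obtain y z where "y \<in> span U" "\<And>w. w \<in> span U \<Longrightarrow> orthogonal z w" "x = y + z"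
    using orthogonal_subspace_decomp_exists by blast
  then have y: "y \<in> U" "\<forall>u\<in>U. orthogonal (x - y) u"
    using assms by (auto simp: span_eq_iff[THEN iffD2])
  then have "orth_proj U x = y"
    using assms orth_proj_unique by blast
  with y show "orth_proj U x \<in> U" and "\<And>u. u \<in> U \<Longrightarrow> orthogonal (x - orth_proj U x) u"
    by auto
qed

text \<open>A family is given by its index set \<open>I\<close>, its subspaces \<open>U\<close> and its weights \<open>w\<close>,
  so the same weighted subspace may occur several times; values outside \<open>I\<close> are irrelevant.\<close>

definition tight_fusion_frame ::
    "nat \<Rightarrow> 'i set \<Rightarrow> ('i \<Rightarrow> 'a::euclidean_space set) \<Rightarrow> ('i \<Rightarrow> real) \<Rightarrow> bool"
  where "tight_fusion_frame p I U w \<longleftrightarrow>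
    finite I \<and> (\<forall>j\<in>I. subspace (U j) \<and> 0 < w j) \<and>
    (\<exists>A>0. \<forall>x. (\<Sum>j\<in>I. w j * norm (orth_proj (U j) x) ^ (2 * p)) = A * norm x ^ (2 * p))"

end

theory Submission
  imports Defs
begin

text \<open>
  A norm-preserving linear map \<open>g\<close> whose range is a subspace \<open>W\<close> identifies the source with \<open>W\<close>
  as inner product spaces. Projecting onto a subspace \<open>g ` V\<close> of \<open>W\<close> can therefore be done in two
  stages: project onto \<open>W\<close>, pull the result back along \<open>g\<close>, project onto \<open>V\<close>, and map forward again;
  this is lemma \<open>orth_proj_isometry_image\<close>. The last stage preserves norms, so for a fixed \<open>W\<close> the
  weighted sum over the transported frame at \<open>x\<close> is the sum over the original frame at the pullback
  of \<open>P\<^sub>W x\<close>. Tightness evaluates it to a constant multiple of \<open>\<parallel>P\<^sub>W x\<parallel>\<^bsup>2p\<^esup>\<close>, where the constant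
  does not depend on \<open>W\<close> (lemma \<open>tight_fusion_frame_isometry_image_sum\<close>). Summing over the outer
  frame then uses its tightness, and the bound of the composed frame is the product of the two bounds.
\<close>

text \<open>Polarization: the norm determines the inner product.\<close>

lemma inner_linear_isometry:
  fixes g :: "'a::real_inner \<Rightarrow> 'b::real_inner"
  assumes "linear g" "\<And>x. norm (g x) = norm x"
  shows "g x \<bullet> g y = x \<bullet> y"
  using assms by (simp add: dot_norm linear_add[symmetric])

text \<open>Isometries are injective, so equality of dimensions forces the range to fill the target.\<close>

lemma range_linear_isometry_eq:
  fixes g :: "'a::euclidean_space \<Rightarrow> 'b::euclidean_space"
  assumes "linear g" "\<And>x. norm (g x) = norm x"
    and "range g \<subseteq> W" "subspace W" "dim W = DIM('a)"
  shows "range g = W"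
proof -
  have "inj g"
    using assms(1,2) by (metis linear_injective_0 norm_eq_zero)
  then have "dim (range g) = DIM('a)"
    using assms(1) by (simp add: dim_image_eq)
  moreover have "subspace (range g)"
    using assms(1) by (simp add: linear_subspace_image)
  ultimately show ?thesis
    using assms(3-5) by (simp add: subspace_dim_equal)
qed

text \<open>
  Write \<open>P\<^sub>W x = g y\<close>. The residual splits as
  \<open>x - g (P\<^sub>V y) = (x - P\<^sub>W x) + g (y - P\<^sub>V y)\<close>. The first summand is orthogonal to all of \<open>W\<close>,
  and the second to \<open>g ` V\<close> because \<open>g\<close> preserves inner products.
\<close>

lemma orth_proj_isometry_image:
  fixes g :: "'a::euclidean_space \<Rightarrow> 'b::euclidean_space"
  assumes g: "linear g" "\<And>x. norm (g x) = norm x"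
    and V: "subspace V"
    and y: "orth_proj (range g) x = g y"
  shows "orth_proj (g ` V) x = g (orth_proj V y)"
proof (rule orth_proj_unique)
  show "subspace (g ` V)"
    using g(1) V by (rule linear_subspace_image)
  show "g (orth_proj V y) \<in> g ` V"
    using orth_proj(1)[OF V] by blast
  have "subspace (range g)"
    using g(1) by (simp add: linear_subspace_image)
  then have "orthogonal (x - g y) (g u)" for u
    using orth_proj(2)[of "range g" "g u" x] y by simp
  moreover have "orthogonal (g (y - orth_proj V y)) (g u)" if "u \<in> V" for u
    using orth_proj(2)[OF V that] by (simp add: orthogonal_def inner_linear_isometry[OF g])
  moreover have "x - g (orth_proj V y) = (x - g y) + g (y - orth_proj V y)"
    using g(1) by (simp add: linear_diff)
  ultimately show "\<forall>u\<in>g ` V. orthogonal (x - g (orth_proj V y)) u"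
    by (auto simp only: orthogonal_clauses)
qed

lemma tight_fusion_frame_isometry_image_sum:
  fixes g :: "'a::euclidean_space \<Rightarrow> 'b::euclidean_space"
  assumes g: "linear g" "\<And>x. norm (g x) = norm x"
    and V: "\<And>j. j \<in> J \<Longrightarrow> subspace (V j)"
    and tight: "\<And>y. (\<Sum>j\<in>J. v j * norm (orth_proj (V j) y) ^ (2 * p)) = A * norm y ^ (2 * p)"
  shows "(\<Sum>j\<in>J. v j * norm (orth_proj (g ` V j) x) ^ (2 * p))
    = A * norm (orth_proj (range g) x) ^ (2 * p)"
proof -
  have "orth_proj (range g) x \<in> range g"
    using g(1) by (simp add: orth_proj(1) linear_subspace_image)
  then obtain y where y: "orth_proj (range g) x = g y"
    by blast
  have "norm (orth_proj (g ` V j) x) = norm (orth_proj (V j) y)" if "j \<in> J" for j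
    using orth_proj_isometry_image[OF g V[OF that] y] g(2) by simp
  then show ?thesis
    using tight[of y] by (simp add: y g(2))
qed

theorem theorem6p5:
  fixes p n m :: nat
    and V :: "nat \<Rightarrow> (real ^ 'l) set" and v :: "nat \<Rightarrow> real"
    and W :: "nat \<Rightarrow> (real ^ 'd) set" and \<omega> :: "nat \<Rightarrow> real"
    and f :: "nat \<Rightarrow> real ^ 'l \<Rightarrow> real ^ 'd"
  assumes "1 \<le> p"
    and "CARD('l) < CARD('d)"
    and "\<And>j. j \<in> {1..n} \<Longrightarrow> subspace (V j) \<and> 0 < v j"
    and "\<And>i. i \<in> {1..m} \<Longrightarrow> subspace (W i) \<and> dim (W i) = CARD('l) \<and> 0 < \<omega> i"
    and "\<And>i. i \<in> {1..m} \<Longrightarrow> linear (f i) \<and> (\<forall>x. norm (f i x) = norm x) \<and> range (f i) \<subseteq> W i"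
    and "tight_fusion_frame p {1..n} V v"
    and "tight_fusion_frame p {1..m} W \<omega>"
  shows "tight_fusion_frame p ({1..m} \<times> {1..n}) (\<lambda>(i, j). f i ` V j) (\<lambda>(i, j). \<omega> i * v j)"
proof -
  obtain A where A: "A > 0"
    "\<And>y. (\<Sum>j\<in>{1..n}. v j * norm (orth_proj (V j) y) ^ (2 * p)) = A * norm y ^ (2 * p)"
    using assms(6) unfolding tight_fusion_frame_def by blast
  obtain B where B: "B > 0"
    "\<And>x. (\<Sum>i\<in>{1..m}. \<omega> i * norm (orth_proj (W i) x) ^ (2 * p)) = B * norm x ^ (2 * p)"
    using assms(7) unfolding tight_fusion_frame_def by blast
  have inner_sum: "(\<Sum>j\<in>{1..n}. v j * norm (orth_proj (f i ` V j) x) ^ (2 * p))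
      = A * norm (orth_proj (W i) x) ^ (2 * p)" if i: "i \<in> {1..m}" for i x
  proof -
    have "range (f i) = W i"
      using assms(4,5)[OF i] by (intro range_linear_isometry_eq) auto
    moreover have "linear (f i)" "\<And>x. norm (f i x) = norm x"
      using assms(5)[OF i] by auto
    ultimately show ?thesis
      using tight_fusion_frame_isometry_image_sum[of "f i" "{1..n}" V v p A x] assms(3) A(2)
      by simp
  qed
  have "(\<Sum>(i, j)\<in>{1..m} \<times> {1..n}. \<omega> i * v j * norm (orth_proj (f i ` V j) x) ^ (2 * p))
      = A * B * norm x ^ (2 * p)" for x
  proof -
    have "(\<Sum>(i, j)\<in>{1..m} \<times> {1..n}. \<omega> i * v j * norm (orth_proj (f i ` V j) x) ^ (2 * p))
        = (\<Sum>i\<in>{1..m}. \<omega> i * (\<Sum>j\<in>{1..n}. v j * norm (orth_proj (f i ` V j) x) ^ (2 * p)))"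
      by (simp add: sum.cartesian_product[symmetric] sum_distrib_left mult.assoc)
    also have "\<dots> = (\<Sum>i\<in>{1..m}. A * (\<omega> i * norm (orth_proj (W i) x) ^ (2 * p)))"
      by (intro sum.cong refl) (simp only: inner_sum mult.left_commute)
    also have "\<dots> = A * (B * norm x ^ (2 * p))"
      by (simp only: sum_distrib_left[symmetric] B(2))
    finally show ?thesis
      by simp
  qed
  moreover have "subspace (f i ` V j) \<and> 0 < \<omega> i * v j" if "i \<in> {1..m}" "j \<in> {1..n}" for i j
    using assms(3)[OF that(2)] assms(4,5)[OF that(1)] by (simp add: linear_subspace_image)
  ultimately show ?thesis
    unfolding tight_fusion_frame_def using A(1) B(1)
    by (auto simp: case_prod_unfold intro!: exI[of _ "A * B"])
qed

end
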